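(* Let $\mathbb{F}$ be a field, and let $X$ and $Y$ be simplicial complexes on the same finite vertex set $V$. Let $M$ be a matroid on the ground set $V$ (identified with the simplicial complex of its independent sets) with rank function $\rho_M$. Suppose that $Y^{\vee} \subset M \subset X$, where $Y^{\vee}=\{A \subset V : V \setminus A \notin Y\}$. Then there exists a simplex $\sigma \in X$ such that $\rho_M(V \setminus \sigma) \leq L_Y(X;\mathbb{F})$.
   Context: All homology is reduced simplicial homology $\tilde H_i(\cdot)=\tilde H_i(\cdot;\mathbb{F})$ with coefficients in the field $\mathbb{F}$. For $S \subset V$, the induced subcomplex is $X[S]=\{\tau \in X : \tau \subset S\}$. The relative Leray number of $X$ with respect to $Y$ is $L_Y(X;\mathbb{F})=\min\{d : \tilde H_i(X[V\setminus \sigma];\mathbb{F})=0 \text{ for all } i \geq d \text{ and all } \sigma \in Y\}$. $Y^{\vee}$ is the Alexander dual of $Y$ with respect to the full simplex on $V$. *)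

theory Defs
  imports "HOL-Algebra.Elementary_Groups" "HOL-Combinatorics.Permutations"
begin

text \<open>
  A simplicial complex on \<open>V\<close> is a down-closed family of subsets of \<open>V\<close>. Points of \<open>V\<close> need not
  be vertices of the complex, and the family may be empty: both happen for Alexander duals
  (the dual of the full simplex is the empty family, which differs from \<open>{{}}\<close>).
\<close>

definition asimplicial_complex :: "'a set \<Rightarrow> 'a set set \<Rightarrow> bool" where
  "asimplicial_complex V X \<longleftrightarrow>
     finite V \<and> X \<subseteq> Pow V \<and> (\<forall>\<sigma>\<in>X. \<forall>\<tau>. \<tau> \<subseteq> \<sigma> \<longrightarrow> \<tau> \<in> X)"

definition induced_subcomplex :: "'a set set \<Rightarrow> 'a set \<Rightarrow> 'a set set" where
  "induced_subcomplex X S = {\<tau> \<in> X. \<tau> \<subseteq> S}"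

definition alexander_dual :: "'a set \<Rightarrow> 'a set set \<Rightarrow> 'a set set" where
  "alexander_dual V Y = {A. A \<subseteq> V \<and> V - A \<notin> Y}"

definition matroid :: "'a set \<Rightarrow> 'a set set \<Rightarrow> bool" where
  "matroid V M \<longleftrightarrow>
     asimplicial_complex V M \<and> M \<noteq> {} \<and>
     (\<forall>A\<in>M. \<forall>B\<in>M. card A < card B \<longrightarrow> (\<exists>b\<in>B - A. insert b A \<in> M))"

definition matroid_rank :: "'a set set \<Rightarrow> 'a set \<Rightarrow> nat" where
  "matroid_rank M S = Max (card ` {A \<in> M. A \<subseteq> S})"

text \<open>
  Oriented simplicial chains, without reference to an order on the vertices. A list without
  repetitions stands for the oriented simplex \<open>[v\<^sub>0, \<dots>, v\<^sub>i]\<close>, and an \<open>i\<close>-chain is given by its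
  coefficients: \<open>c xs\<close> is the coefficient of the oriented simplex \<open>xs\<close>, which changes by the sign
  of the permutation when the vertices are permuted. Coefficients are zero at all lists that do
  not order an \<open>i\<close>-simplex. The empty list orders the empty simplex, of dimension \<open>-1\<close>, so the
  complex is the augmented one.
\<close>

definition oriented_chains :: "'a set set \<Rightarrow> int \<Rightarrow> ('a list \<Rightarrow> 'f::field) set" where
  "oriented_chains K i = {c.
     (\<forall>xs. c xs \<noteq> 0 \<longrightarrow> distinct xs \<and> set xs \<in> K \<and> int (length xs) = i + 1) \<and>
     (\<forall>xs p. p permutes {..<length xs} \<longrightarrow> c (permute_list p xs) = of_int (sign p) * c xs)}"

text \<open>
  The linear extension of \<open>\<partial>[v\<^sub>0, \<dots>, v\<^sub>i] = \<Sum>\<^sub>j (-1)\<^sup>j [v\<^sub>0, \<dots>, v\<^sub>j\<^sub>-\<^sub>1, v\<^sub>j\<^sub>+\<^sub>1, \<dots>, v\<^sub>i]\<close>: moving the vertex that is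
  deleted to the front, the coefficient of \<open>xs\<close> in \<open>\<partial>c\<close> is the sum of the coefficients of
  the \<open>v # xs\<close> in \<open>c\<close>. In degree \<open>0\<close> this is the augmentation.
\<close>

definition simplicial_boundary :: "'a set set \<Rightarrow> ('a list \<Rightarrow> 'f::field) \<Rightarrow> 'a list \<Rightarrow> 'f" where
  "simplicial_boundary K c = (\<lambda>xs. \<Sum>v\<in>\<Union>K. c (v # xs))"

definition simplicial_cycles :: "'a set set \<Rightarrow> int \<Rightarrow> ('a list \<Rightarrow> 'f::field) set" where
  "simplicial_cycles K i = {c \<in> oriented_chains K i. simplicial_boundary K c = (\<lambda>xs. 0)}"

definition simplicial_boundaries :: "'a set set \<Rightarrow> int \<Rightarrow> ('a list \<Rightarrow> 'f::field) set" where
  "simplicial_boundaries K i = simplicial_boundary K ` oriented_chains K (i + 1)"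

definition cycle_group :: "'a set set \<Rightarrow> int \<Rightarrow> ('a list \<Rightarrow> 'f::field) monoid" where
  "cycle_group K i =
     \<lparr>carrier = simplicial_cycles K i, monoid.mult = (\<lambda>c d xs. c xs + d xs), one = (\<lambda>xs. 0)\<rparr>"

definition reduced_simplicial_homology ::
    "'a set set \<Rightarrow> int \<Rightarrow> ('a list \<Rightarrow> 'f::field) set monoid" where
  "reduced_simplicial_homology K i = cycle_group K i Mod simplicial_boundaries K i"

text \<open>
  The minimum is over the natural numbers, so that a Leray number is never negative even when
  the reduced homology in degree \<open>-1\<close> vanishes as well. It is attained, since homology vanishes
  in degrees \<open>\<ge> card V\<close>. The first argument carries the coefficient field.
\<close>

definition relative_leray_number ::
    "'f::field itself \<Rightarrow> 'a set \<Rightarrow> 'a set set \<Rightarrow> 'a set set \<Rightarrow> nat" where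
  "relative_leray_number F V Y X =
     (LEAST d. \<forall>i\<ge>int d. \<forall>\<sigma>\<in>Y. trivial_group
        (reduced_simplicial_homology (induced_subcomplex X (V - \<sigma>)) i
           :: ('a list \<Rightarrow> 'f) set monoid))"

end

theory Submission
  imports Defs
begin

text \<open>
  If \<open>\<sigma> \<notin> Y\<close>, then \<open>V - \<sigma>\<close> lies in the Alexander dual, so it is a simplex of \<open>X\<close>. Hence with
  \<open>d = L\<^sub>Y(X)\<close> the complex \<open>X[V - \<sigma>]\<close> is acyclic in degrees \<open>\<ge> d\<close> for all \<open>\<sigma> \<in> X\<close>. Suppose that
  \<open>V - \<sigma>\<close> has rank \<open>> d\<close> for all \<open>\<sigma> \<in> X\<close>. The matroid complex \<open>M[V - \<sigma>]\<close> is then acyclic in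
  degrees \<open>< d\<close>, and the method of acyclic carriers, with values in \<open>M\<close> up to dimension \<open>d\<close> and
  in \<open>X\<close> beyond, yields a chain version of a null-homotopic map \<open>X \<rightarrow> X\<close> that maps a point
  with maximal barycentric coordinates on \<open>\<sigma>\<close> into \<open>X[V - \<sigma>]\<close>. This map has no fixed
  point, against the Lefschetz trace formula.
\<close>

section \<open>Simplicial chains as functions on finite sets\<close>

text \<open>Signs are taken relative to an arbitrary ordering of each finite set, since the vertices
  carry no linear order.\<close>

definition orient :: "'a set \<Rightarrow> 'a list" where
  "orient A = (SOME xs. distinct xs \<and> set xs = A)"

lemma orient: "finite A \<Longrightarrow> distinct (orient A) \<and> set (orient A) = A"
  unfolding orient_def by (rule someI_ex) (use finite_distinct_list in blast)

section \<open>Signs of vertex orderings\<close>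

definition list_sign :: "'a list \<Rightarrow> int" where
  "list_sign xs =
     sign (SOME p. p permutes {..<length xs} \<and> permute_list p (orient (set xs)) = xs)"

lemma permute_list_inj:
  assumes "distinct xs" "p permutes {..<length xs}" "q permutes {..<length xs}"
    and "permute_list p xs = permute_list q xs"
  shows "p = q"
proof
  fix i
  show "p i = q i"
  proof (cases "i < length xs")
    case True
    have "xs ! p i = xs ! q i"
      using permute_list_nth[OF assms(2) True] permute_list_nth[OF assms(3) True] assms(4) by simp
    moreover have "p i < length xs" "q i < length xs"
      using True assms(2,3) permutes_in_image by fastforce+
    ultimately show ?thesis using assms(1) nth_eq_iff_index_eq by blast
  next
    case False
    then show ?thesis using assms(2,3) by (simp add: permutes_not_in)
  qed
qed

text \<open>On a list without repetitions the permutation chosen in \<open>list_sign\<close> is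
  unique, so any witness computes the sign.\<close>

lemma list_sign_eq:
  assumes "distinct xs" "p permutes {..<length xs}" "permute_list p (orient (set xs)) = xs"
  shows "list_sign xs = sign p"
proof -
  have len: "length (orient (set xs)) = length xs"
    using orient[of "set xs"] assms(1) by (metis List.finite_set distinct_card)
  have "(SOME p. p permutes {..<length xs} \<and> permute_list p (orient (set xs)) = xs) = p"
    using assms(2,3) permute_list_inj[of "orient (set xs)"] orient[of "set xs"] len
    by (intro some_equality) auto
  then show ?thesis by (simp add: list_sign_def)
qed

lemma ex_permute_list:
  assumes "distinct xs" "distinct ys" "set xs = set ys"
  obtains p where "p permutes {..<length ys}" "permute_list p ys = xs" "length xs = length ys"
proof -
  have "mset xs = mset ys" using assms set_eq_iff_mset_eq_distinct by blast
  then show thesis using that mset_eq_permutation[of xs ys] mset_eq_length by metis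
qed

lemma list_sign_permute_list:
  assumes "distinct xs" "p permutes {..<length xs}"
  shows "list_sign (permute_list p xs) = sign p * list_sign xs"
proof -
  obtain q where q: "q permutes {..<length (orient (set xs))}"
    "permute_list q (orient (set xs)) = xs" "length xs = length (orient (set xs))"
    using ex_permute_list[OF assms(1), of "orient (set xs)"] orient[of "set xs"] by auto
  have "permute_list (q \<circ> p) (orient (set xs)) = permute_list p xs"
    using q assms(2) by (simp add: permute_list_compose)
  moreover have "q \<circ> p permutes {..<length xs}"
    using permutes_compose[OF assms(2)] q by simp
  ultimately have "list_sign (permute_list p xs) = sign (q \<circ> p)"
    using assms by (intro list_sign_eq) (auto simp: distinct_permute_list)
  moreover have "list_sign xs = sign q" using assms(1) q by (intro list_sign_eq) auto
  moreover have "permutation p" "permutation q"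
    using assms(2) q(1) permutation_permutes by blast+
  ultimately show ?thesis by (simp add: sign_compose)
qed

text \<open>\<open>p\<close> is transported along \<open>Suc\<close>, leaving position 0 to
  \<open>v\<close>; transport along an injection preserves the sign.\<close>

lemma Cons_permute_list:
  assumes "p permutes {..<length xs}"
  obtains q where "q permutes {..<length (v # xs)}" "sign q = sign p"
    "permute_list q (v # xs) = v # permute_list p xs"
proof -
  let ?q = "map_permutation {..<length xs} Suc p"
  have q: "?q permutes Suc ` {..<length xs}"
    using assms by (intro map_permutation_permutes) (auto simp: bij_betw_def)
  have "permute_list ?q (v # xs) = v # permute_list p xs"
  proof (rule nth_equalityI)
    fix i assume i: "i < length (permute_list ?q (v # xs))"
    have "?q 0 = 0" using q by (simp add: permutes_not_in)
    moreover have "?q (Suc j) = Suc (p j)" if "j < length xs" for j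
      using that map_permutation_apply[of Suc "{..<length xs}" j p] by simp
    ultimately show "permute_list ?q (v # xs) ! i = (v # permute_list p xs) ! i"
      using i by (cases i) (auto simp: permute_list_def simp del: upt_Suc)
  qed simp
  moreover have "?q permutes {..<length (v # xs)}"
    using q by (rule permutes_subset) auto
  moreover have "sign ?q = sign p"
    using assms by (intro sign_map_permutation) auto
  ultimately show thesis using that by blast
qed

text \<open>\<open>sign\<close> is 1 or -1 whatever permutation \<open>list_sign\<close> chose, so
  the square is 1 for lists with repetitions too.\<close>

lemma of_int_list_sign_cancel:
  "of_int (list_sign xs) * (of_int (list_sign xs) * k) = (k :: 'f::field)"
  unfolding mult.assoc[symmetric] of_int_mult[symmetric] by (simp add: list_sign_def)

lemma list_sign_swap:
  assumes "distinct (v # w # xs)"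
  shows "list_sign (w # v # xs) = - list_sign (v # w # xs)"
proof -
  let ?p = "transpose 0 (Suc 0)"
  have "?p permutes {..<length (v # w # xs)}"
    by (rule permutes_swap_id) auto
  moreover have "permute_list ?p (v # w # xs) = w # v # xs"
    by (rule nth_equalityI)
      (auto simp: permute_list_def transpose_def nth_Cons' simp del: upt_Suc)
  ultimately show ?thesis
    using list_sign_permute_list[OF assms, of ?p] by (simp add: sign_swap_id)
qed

section \<open>Incidence numbers of faces\<close>

definition incidence :: "'a \<Rightarrow> 'a set \<Rightarrow> 'f::field" where
  "incidence v A = of_int (list_sign (v # orient A) * list_sign (orient A))"

lemma incidence_square: "incidence v A * incidence v A = 1"
  using of_int_list_sign_cancel[of _ 1]
  by (simp add: incidence_def of_int_list_sign_cancel mult_ac)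

lemma incidence_cancel: "incidence v A * (incidence v A * k) = k"
  by (simp add: incidence_square flip: mult.assoc)

text \<open>Passing from the reference ordering to \<open>xs\<close> changes both factors of
  \<open>incidence\<close> by the same sign. The product form thus makes \<open>incidence\<close>
  computable from any ordering of the face.\<close>

lemma incidence_set:
  assumes "distinct (v # xs)"
  shows "incidence v (set xs) = (of_int (list_sign (v # xs) * list_sign xs) :: 'f::field)"
proof -
  have L: "distinct (orient (set xs))" "set (orient (set xs)) = set xs"
    using orient[of "set xs"] by auto
  obtain p where p: "p permutes {..<length (orient (set xs))}"
    "permute_list p (orient (set xs)) = xs"
    using ex_permute_list[of xs "orient (set xs)"] assms L by auto
  obtain q where q: "q permutes {..<length (v # orient (set xs))}" "sign q = sign p"
    "permute_list q (v # orient (set xs)) = v # xs"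
    using Cons_permute_list[OF p(1), of v] p(2) by metis
  have "list_sign xs = sign p * list_sign (orient (set xs))"
    using list_sign_permute_list[OF L(1) p(1)] p(2) by simp
  moreover have "list_sign (v # xs) = sign p * list_sign (v # orient (set xs))"
    using list_sign_permute_list[OF _ q(1)] q assms L by simp
  ultimately have "list_sign (v # xs) * list_sign xs =
      list_sign (v # orient (set xs)) * list_sign (orient (set xs))"
    by (simp add: mult_ac)
  then show ?thesis by (simp only: incidence_def)
qed

text \<open>The sign rule behind \<partial>\<partial> = 0: for an ordering \<open>xs\<close> of
  \<open>A\<close>, the two products compare \<open>v # w # xs\<close> and \<open>w # v # xs\<close>
  with \<open>xs\<close>, and these differ by one transposition.\<close>

lemma incidence_anticommute:
  assumes "finite A" "v \<notin> A" "w \<notin> A" "v \<noteq> w"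
  shows "incidence v (insert w A) * incidence w A =
    - (incidence w (insert v A) * incidence v A :: 'f::field)"
proof -
  obtain xs where xs: "distinct xs" "set xs = A" using finite_distinct_list assms by blast
  have "(incidence v (set (w # xs)) * incidence w (set xs) :: 'f) =
      of_int (list_sign (v # w # xs) * list_sign xs)"
    using xs assms incidence_set[of v "w # xs", where 'f = 'f] incidence_set[of w xs, where 'f = 'f]
    by (simp add: of_int_list_sign_cancel mult_ac)
  moreover have "(incidence w (set (v # xs)) * incidence v (set xs) :: 'f) =
      of_int (list_sign (w # v # xs) * list_sign xs)"
    using xs assms incidence_set[of w "v # xs", where 'f = 'f] incidence_set[of v xs, where 'f = 'f]
    by (simp add: of_int_list_sign_cancel mult_ac)
  ultimately show ?thesis using list_sign_swap[of v w xs] xs assms by simp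
qed

text \<open>The same rule, solved for the pair of coefficients that meet in the boundary of a
  cone.\<close>

lemma incidence_anticommute':
  assumes "finite A" "v \<notin> A" "w \<notin> A" "v \<noteq> w"
  shows "incidence v (insert w A) * incidence w (insert v A) =
    - (incidence v A * incidence w A :: 'f::field)"
proof -
  have "incidence v (insert w A) * incidence w (insert v A) =
      (incidence v (insert w A) * incidence w A) * (incidence w A * incidence w (insert v A) :: 'f)"
    by (simp add: incidence_square[of w A] flip: mult.assoc)
  also have "\<dots> = - (incidence w (insert v A) * incidence w (insert v A) * (incidence v A * incidence w A))"
    unfolding incidence_anticommute[OF assms] by (simp add: mult_ac)
  finally show ?thesis by (simp add: incidence_square)
qed

section \<open>Set-indexed chains and their identification with alternating chains\<close>

definition simplex_chains :: "'a set set \<Rightarrow> nat \<Rightarrow> ('a set \<Rightarrow> 'f::field) set" where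
  "simplex_chains K q = {c. \<forall>A. c A \<noteq> 0 \<longrightarrow> A \<in> K \<and> card A = q}"

text \<open>The sum runs over the ambient set \<open>V\<close> rather than the vertices of a
  complex, so that one operator serves all carriers and links.\<close>

definition boundary :: "'a set \<Rightarrow> ('a set \<Rightarrow> 'f::field) \<Rightarrow> 'a set \<Rightarrow> 'f" where
  "boundary V c A = (\<Sum>v\<in>V - A. incidence v A * c (insert v A))"

definition alternating_extension :: "('a set \<Rightarrow> 'f::field) \<Rightarrow> 'a list \<Rightarrow> 'f" where
  "alternating_extension c xs = (if distinct xs then of_int (list_sign xs) * c (set xs) else 0)"

text \<open>The shift by 1 arises because \<open>simplex_chains\<close> is graded by cardinality:
  degree 0 there is the augmentation degree -1.\<close>

lemma alternating_extension_in_oriented_chains: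
  assumes "c \<in> simplex_chains K q"
  shows "alternating_extension c \<in> oriented_chains K (int q - 1)"
  using assms
  by (auto simp: oriented_chains_def simplex_chains_def alternating_extension_def distinct_card
      list_sign_permute_list)

text \<open>The two boundaries correspond because \<open>incidence\<close> is the ratio of the signs
  of \<open>v # xs\<close> and \<open>xs\<close>.\<close>

lemma simplicial_boundary_alternating_extension:
  fixes c :: "'a set \<Rightarrow> 'f::field"
  assumes "finite V" "K \<subseteq> Pow V" "c \<in> simplex_chains K q"
  shows "simplicial_boundary K (alternating_extension c) = alternating_extension (boundary V c)"
proof
  fix xs
  show "simplicial_boundary K (alternating_extension c) xs = alternating_extension (boundary V c) xs"
  proof (cases "distinct xs")
    case True
    have "finite (\<Union>K)" using assms(1,2) by (meson Sup_le_iff PowD finite_subset subsetD)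
    have "simplicial_boundary K (alternating_extension c) xs =
        (\<Sum>v\<in>\<Union>K - set xs. of_int (list_sign (v # xs)) * c (insert v (set xs)))"
      unfolding simplicial_boundary_def using \<open>finite (\<Union>K)\<close> True
      by (intro sum.mono_neutral_cong_right) (auto simp: alternating_extension_def)
    \<comment> \<open>Vertices outside \<open>\<Union>K\<close> contribute nothing, since
      \<open>c\<close> is supported on \<open>K\<close>.\<close>
    also have "\<dots> = (\<Sum>v\<in>V - set xs. of_int (list_sign (v # xs)) * c (insert v (set xs)))"
      using assms by (intro sum.mono_neutral_left) (auto simp: simplex_chains_def)
    also have "\<dots> = (\<Sum>v\<in>V - set xs. of_int (list_sign xs) *
        (incidence v (set xs) * c (insert v (set xs))))"
    proof (rule sum.cong)
      fix v assume v: "v \<in> V - set xs"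
      show "of_int (list_sign (v # xs)) * c (insert v (set xs)) =
          of_int (list_sign xs) * (incidence v (set xs) * c (insert v (set xs)))"
        using v True incidence_set[of v xs, where 'f = 'f]
        by (simp add: of_int_list_sign_cancel mult_ac)
    qed simp
    finally show ?thesis
      using True by (simp add: alternating_extension_def boundary_def sum_distrib_left)
  qed (simp add: alternating_extension_def simplicial_boundary_def)
qed

text \<open>An alternating function is determined by its values on the reference orderings; infinite
  sets have no ordering and get the value 0.\<close>

lemma oriented_chain_eq_alternating_extension:
  assumes "e \<in> oriented_chains K (int q - 1)"
  obtains c where "c \<in> simplex_chains K q" "e = alternating_extension c"
proof
  let ?c = "\<lambda>A. if finite A then of_int (list_sign (orient A)) * e (orient A) else 0"
  have "A \<in> K \<and> card A = q" if "?c A \<noteq> 0" for A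
  proof -
    have "finite A" "e (orient A) \<noteq> 0" using that by (auto split: if_splits)
    then have "set (orient A) \<in> K" "length (orient A) = q"
      using assms(1) by (auto simp: oriented_chains_def)
    then show ?thesis using orient[OF \<open>finite A\<close>] distinct_card by metis
  qed
  then show "?c \<in> simplex_chains K q" by (simp add: simplex_chains_def)
  show "e = alternating_extension ?c"
  proof
    fix xs
    show "e xs = alternating_extension ?c xs"
    proof (cases "distinct xs")
      case True
      let ?L = "orient (set xs)"
      have L: "distinct ?L" "set ?L = set xs" using orient[of "set xs"] by auto
      obtain p where p: "p permutes {..<length ?L}" "permute_list p ?L = xs"
        using ex_permute_list[of xs ?L] L True by auto
      have "list_sign xs = sign p * list_sign ?L"
        using list_sign_permute_list[OF L(1) p(1)] p(2) by simp
      moreover have "e xs = of_int (sign p) * e ?L"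
        using assms(1) p unfolding oriented_chains_def by fastforce
      moreover have "of_int (list_sign ?L) * (of_int (list_sign ?L) * e ?L) = e ?L"
        by (rule of_int_list_sign_cancel)
      ultimately show ?thesis using True by (simp add: alternating_extension_def mult.assoc)
    next
      case False
      then show ?thesis using assms(1) by (auto simp: alternating_extension_def oriented_chains_def)
    qed
  qed
qed

lemma boundary_add: "boundary V (\<lambda>A. c A + d A) = (\<lambda>A. boundary V c A + boundary V d A)"
  by (simp add: boundary_def fun_eq_iff distrib_left sum.distrib)

lemma boundary_diff: "boundary V (\<lambda>A. c A - d A) = (\<lambda>A. boundary V c A - boundary V d A)"
  by (simp add: boundary_def fun_eq_iff right_diff_distrib sum_subtractf)

lemma boundary_sum:
  "boundary V (\<lambda>A. \<Sum>i\<in>I. k i * c i A) = (\<lambda>A. \<Sum>i\<in>I. k i * boundary V (c i) A)"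
  unfolding boundary_def fun_eq_iff sum_distrib_left
  by (subst sum.swap) (simp add: mult_ac)

lemma simplex_chains_diff:
  assumes "c \<in> simplex_chains K q" "d \<in> simplex_chains K q"
  shows "(\<lambda>A. c A - d A) \<in> simplex_chains K q"
proof -
  have "A \<in> K \<and> card A = q" if "c A - d A \<noteq> 0" for A
    using that assms by (cases "c A = 0") (simp_all add: simplex_chains_def)
  then show ?thesis by (simp add: simplex_chains_def)
qed

section \<open>Acyclicity of matroid complexes\<close>

text \<open>The join with \<open>v\<close>, with \<open>v\<close> put first. Simplices of
  \<open>c\<close> that already contain \<open>v\<close> are dropped.\<close>

definition cone :: "'a \<Rightarrow> ('a set \<Rightarrow> 'f::field) \<Rightarrow> 'a set \<Rightarrow> 'f" where
  "cone v c A = (if v \<in> A then incidence v (A - {v}) * c (A - {v}) else 0)"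

lemma cone_zero: "cone v (\<lambda>_. 0) = (\<lambda>_. 0)"
  by (simp add: cone_def fun_eq_iff)

lemma cone_in_simplex_chains:
  assumes "c \<in> simplex_chains K q" "\<And>A. A \<in> K \<Longrightarrow> v \<notin> A \<Longrightarrow> finite A \<and> insert v A \<in> L"
  shows "cone v c \<in> simplex_chains L (Suc q)"
proof -
  have "A \<in> L \<and> card A = Suc q" if "cone v c A \<noteq> 0" for A
  proof -
    have A: "v \<in> A" "c (A - {v}) \<noteq> 0" using that by (auto simp: cone_def split: if_splits)
    then have "A - {v} \<in> K" "card (A - {v}) = q" using assms(1) by (auto simp: simplex_chains_def)
    then have "finite (A - {v})" "insert v (A - {v}) \<in> L" using assms(2)[of "A - {v}"] by auto
    then show ?thesis using A(1) \<open>card (A - {v}) = q\<close> card_Suc_Diff1[of A v]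
      by (simp add: insert_absorb)
  qed
  then show ?thesis by (simp add: simplex_chains_def)
qed

text \<open>A face off \<open>v\<close> arises only by deleting \<open>v\<close>, which returns
  \<open>c\<close>. On faces through \<open>v\<close>, exchanging \<open>v\<close> with the deleted
  vertex produces the minus sign.\<close>

lemma boundary_cone:
  assumes V: "finite V" "v \<in> V" and c: "\<And>A. c A \<noteq> 0 \<Longrightarrow> A \<subseteq> V - {v}"
  shows "boundary V (cone v c) = (\<lambda>A. c A - cone v (boundary V c) A)"
proof
  fix A
  show "boundary V (cone v c) A = c A - cone v (boundary V c) A"
  proof (cases "v \<in> A")
    case False
    have "boundary V (cone v c) A = (\<Sum>w\<in>{v}. incidence w A * cone v c (insert w A))"
      unfolding boundary_def using V False by (intro sum.mono_neutral_right) (auto simp: cone_def)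
    also have "\<dots> = c A" using False by (simp add: cone_def incidence_cancel)
    finally show ?thesis using False by (simp add: cone_def)
  next
    case True
    define B where "B = A - {v}"
    have A: "A = insert v B" "v \<notin> B" using True by (auto simp: B_def)
    have "boundary V (cone v c) A = (\<Sum>w\<in>V - A. - incidence v B * (incidence w B * c (insert w B)))"
      unfolding boundary_def
    proof (rule sum.cong)
      fix w assume w: "w \<in> V - A"
      then have "insert w A - {v} = insert w B" using A by auto
      then have "incidence w A * cone v c (insert w A) =
          incidence w (insert v B) * incidence v (insert w B) * c (insert w B)"
        using A by (simp add: cone_def)
      also have "\<dots> = - incidence v B * (incidence w B * c (insert w B))"
      proof (cases "c (insert w B) = 0")
        case False
        then have "finite B" using c V(1) finite_subset by fastforce
        then show ?thesis using A w by (subst incidence_anticommute') (auto simp: mult_ac)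
      qed simp
      finally show "incidence w A * cone v c (insert w A) = \<dots>" .
    qed simp
    also have "\<dots> = - incidence v B * (\<Sum>w\<in>V - A. incidence w B * c (insert w B))"
      by (simp only: sum_distrib_left)
    also have "(\<Sum>w\<in>V - A. incidence w B * c (insert w B)) = boundary V c B"
      unfolding boundary_def using V A c by (intro sum.mono_neutral_left) auto
    finally have "boundary V (cone v c) A = - (incidence v B * boundary V c B)" by simp
    moreover have "c A = 0" using c[of A] True by auto
    ultimately show ?thesis using True by (simp add: cone_def B_def)
  qed
qed

text \<open>Only the part \<open>z0\<close> of \<open>z\<close> off \<open>v\<close> is coned. Since
  \<open>z\<close> is a cycle, its part through \<open>v\<close> is recovered from the boundary of
  \<open>z0\<close>. Closure under adding \<open>v\<close> is asked in cardinality \<open>q\<close>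
  only, which is all that the matroid case supplies.\<close>

lemma cone_cycle_fill:
  fixes z :: "'a set \<Rightarrow> 'f::field"
  assumes V: "finite V" "v \<in> V" and z: "z \<in> simplex_chains N q" "boundary V z = (\<lambda>_. 0)"
    and N: "\<And>A. A \<in> N \<Longrightarrow> A \<subseteq> V" "\<And>A. A \<in> N \<Longrightarrow> card A = q \<Longrightarrow> insert v A \<in> N"
  shows "\<exists>e\<in>simplex_chains N (Suc q). boundary V e = z"
proof -
  define z0 where "z0 A = (if v \<in> A then 0 else z A)" for A
  have z0V: "A \<subseteq> V - {v}" if "z0 A \<noteq> 0" for A
    using that z(1) N(1) by (auto simp: z0_def simplex_chains_def split: if_splits)
  have "boundary V z0 A = - (incidence v A * z (insert v A))" if "v \<notin> A" for A
  proof -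
    have "boundary V z A = incidence v A * z (insert v A) +
        (\<Sum>w\<in>V - A - {v}. incidence w A * z (insert w A))"
      unfolding boundary_def using V that by (intro sum.remove) auto
    also have "(\<Sum>w\<in>V - A - {v}. incidence w A * z (insert w A)) = boundary V z0 A"
      unfolding boundary_def using V that
      by (intro sum.mono_neutral_cong_left) (auto simp: z0_def)
    finally show ?thesis using z(2) by (simp add: eq_neg_iff_add_eq_0 add.commute)
  qed
  then have "z0 A - cone v (boundary V z0) A = z A" for A
    by (simp add: cone_def z0_def insert_absorb incidence_cancel)
  then have "boundary V (cone v z0) = z"
    using boundary_cone[OF V, of z0] z0V by (simp add: fun_eq_iff)
  moreover have "z0 \<in> simplex_chains {A \<in> N. card A = q} q"
    using z(1) by (auto simp: simplex_chains_def z0_def)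
  then have "cone v z0 \<in> simplex_chains N (Suc q)"
    using N finite_subset[OF N(1) V(1)] by (intro cone_in_simplex_chains) auto
  ultimately show ?thesis by blast
qed

text \<open>Deletion and contraction of a vertex \<open>v\<close>: the cycle \<open>z\<close> is pushed off \<open>v\<close> by filling
  its link part inside the link of \<open>v\<close>; if this is impossible because \<open>v\<close> is needed
  for the rank, \<open>z\<close> is coned off from \<open>v\<close>.\<close>

lemma matroid_cycle_fill:
  fixes z :: "'a set \<Rightarrow> 'f::field"
  assumes "finite V" "S \<subseteq> V" "matroid S N" "B \<in> N" "q < card B"
    and "z \<in> simplex_chains N q" "boundary V z = (\<lambda>_. 0)"
  shows "\<exists>e\<in>simplex_chains N (Suc q). boundary V e = z"
proof -
  have "finite S" using assms finite_subset by blast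
  then show ?thesis using assms(2-)
  proof (induction S arbitrary: N B q z rule: finite_induct)
    case empty
    then have "B = {}" by (auto simp: matroid_def asimplicial_complex_def)
    then show ?case using empty by simp
  next
    case (insert v S)
    have N: "A \<subseteq> insert v S" "finite A" if "A \<in> N" for A
      using that insert.prems(2) insert.hyps(1) finite_subset[of A "insert v S"]
      by (auto simp: matroid_def asimplicial_complex_def)
    have down: "C \<in> N" if "A \<in> N" "C \<subseteq> A" for A C
      using that insert.prems(2) by (auto simp: matroid_def asimplicial_complex_def)
    have aug: "\<exists>b\<in>C - A. insert b A \<in> N" if "A \<in> N" "C \<in> N" "card A < card C" for A C
      using that insert.prems(2) by (auto simp: matroid_def)
    have v: "v \<in> V" "S \<subseteq> V" using insert.prems(1) by auto
    have z: "A \<in> N" "card A = q" if "z A \<noteq> 0" for A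
      using that insert.prems(5) by (auto simp: simplex_chains_def)
    show ?case
    proof (cases "\<exists>B\<in>N. v \<notin> B \<and> q < card B")
      case False
      \<comment> \<open>\<open>A\<close> can be augmented from the larger set \<open>B\<close>. Any
        new element other than \<open>v\<close> would give an independent set of size
        \<open>q + 1\<close> off \<open>v\<close>.\<close>
      have cone: "insert v A \<in> N" if A: "A \<in> N" "card A = q" for A
      proof (cases "v \<in> A")
        case vA: False
        obtain b where b: "b \<in> B - A" "insert b A \<in> N"
          using aug[OF A(1) insert.prems(3)] A(2) insert.prems(4) by auto
        then have "card (insert b A) = Suc q" using N A by simp
        then have "b = v" using False b vA by fastforce
        then show ?thesis using b by simp
      qed (simp add: A insert_absorb)
      show ?thesis
        using N(1) insert.prems(1) cone
        by (intro cone_cycle_fill[OF \<open>finite V\<close> v(1) insert.prems(5,6)]) blast+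
    next
      case True
      then obtain B' where B': "B' \<in> N" "v \<notin> B'" "q < card B'" by blast
      let ?D = "{A \<in> N. v \<notin> A}"
      let ?L = "{A. v \<notin> A \<and> insert v A \<in> N}"
      have D: "matroid S ?D"
        unfolding matroid_def asimplicial_complex_def
      proof (intro conjI ballI allI impI)
        show "?D \<noteq> {}" using B' by blast
        fix A C assume "A \<in> ?D" "C \<in> ?D" "card A < card C"
        then show "\<exists>b\<in>C - A. insert b A \<in> ?D" using aug[of A C] by auto
      qed (use insert.hyps N down in auto)
      \<comment> \<open>The link part of \<open>z\<close>: its cone from \<open>v\<close> is the
        part of \<open>z\<close> through \<open>v\<close>. Its boundary at \<open>A\<close> is, up
        to sign, that of \<open>z\<close> at \<open>insert v A\<close>, so it is a cycle.\<close>
      define a where "a A = (if v \<in> A then 0 else incidence v A * z (insert v A))" for A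
      have ba: "boundary V a = (\<lambda>_. 0)"
      proof
        fix A
        show "boundary V a A = 0"
        proof (cases "v \<in> A \<or> infinite A")
          case True
          have "a (insert w A) = 0" for w
            using True N(2)[of "insert v (insert w A)"] z[of "insert v (insert w A)"]
            by (auto simp: a_def)
          then show ?thesis by (simp add: boundary_def)
        next
          case vA: False
          have "boundary V a A = (\<Sum>w\<in>V - insert v A. incidence w A * a (insert w A))"
            unfolding boundary_def using \<open>finite V\<close> by (intro sum.mono_neutral_right) (auto simp: a_def)
          also have "\<dots> = (\<Sum>w\<in>V - insert v A. - incidence v A *
              (incidence w (insert v A) * z (insert w (insert v A))))"
          proof (rule sum.cong)
            fix w assume w: "w \<in> V - insert v A"
            have "incidence w A * a (insert w A) =
                (incidence v (insert w A) * incidence w A) * z (insert w (insert v A))"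
              using w vA by (auto simp: a_def insert_commute mult_ac)
            also have "\<dots> = - incidence v A * (incidence w (insert v A) * z (insert w (insert v A)))"
              using w vA by (subst incidence_anticommute) (auto simp: mult_ac)
            finally show "incidence w A * a (insert w A) = \<dots>" .
          qed simp
          also have "\<dots> = - incidence v A * boundary V z (insert v A)"
            by (simp only: boundary_def sum_distrib_left)
          finally show ?thesis using insert.prems(6) by simp
        qed
      qed
      \<comment> \<open>The case \<open>a = 0\<close> is separate because \<open>?L\<close> may then
        be empty or \<open>q\<close> may be 0. Otherwise a simplex of \<open>z\<close> through
        \<open>v\<close> shows that \<open>?L\<close> is a matroid and that \<open>q\<close> is a
        successor.\<close>
      have "\<exists>e\<in>simplex_chains ?L q. boundary V e = a"
      proof (cases "a = (\<lambda>_. 0)")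
        case True
        then show ?thesis by (intro bexI[of _ "\<lambda>_. 0"]) (auto simp: boundary_def simplex_chains_def)
      next
        case False
        then obtain A where A: "v \<notin> A" "z (insert v A) \<noteq> 0"
          unfolding a_def by (metis mult_zero_right)
        then have vA: "insert v A \<in> N" "card (insert v A) = q" using z by auto
        have "finite A" using N(2)[OF vA(1)] by simp
        then obtain q' where q': "q = Suc q'" "card A = q'" using vA A by simp
        have L: "matroid S ?L"
          unfolding matroid_def asimplicial_complex_def
        proof (intro conjI ballI allI impI)
          show "?L \<noteq> {}" using vA A by blast
          show "?L \<subseteq> Pow S" using N by blast
          show "C' \<in> ?L" if "C \<in> ?L" "C' \<subseteq> C" for C C'
            using that down[of "insert v C" "insert v C'"] by auto
          fix A C assume AC: "A \<in> ?L" "C \<in> ?L" "card A < card C"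
          then have "finite A" "finite C" using N(2) by (auto dest: N(2))
          then obtain b where "b \<in> insert v C - insert v A" "insert b (insert v A) \<in> N"
            using aug[of "insert v A" "insert v C"] AC by auto
          then show "\<exists>b\<in>C - A. insert b A \<in> ?L"
            using AC by (intro bexI[of _ b]) (auto simp: insert_commute)
        qed (use insert.hyps in auto)
        \<comment> \<open>Augmenting \<open>insert v A\<close> from \<open>B'\<close> keeps
          \<open>v\<close>; removing \<open>v\<close> afterwards gives the rank above
          \<open>q'\<close> that the induction hypothesis needs in the link.\<close>
        have "\<exists>C\<in>N. v \<in> C \<and> q < card C"
        proof -
          obtain b where b: "b \<in> B' - insert v A" "insert b (insert v A) \<in> N"
            using aug[OF vA(1) B'(1)] vA(2) B'(3) by auto
          then show ?thesis using vA \<open>finite A\<close> by (intro bexI[OF _ b(2)]) (auto simp: card_insert_if)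
        qed
        then obtain C where C: "C \<in> N" "v \<in> C" "q < card C" by blast
        have CL: "C - {v} \<in> ?L" "q' < card (C - {v})"
          using C q' N by (auto simp: insert_absorb)
        have aL: "a \<in> simplex_chains ?L q'"
        proof -
          have "A \<in> ?L \<and> card A = q'" if "a A \<noteq> 0" for A
          proof -
            have *: "v \<notin> A" "z (insert v A) \<noteq> 0" using that by (auto simp: a_def split: if_splits)
            then have **: "insert v A \<in> N" "card (insert v A) = q" using z by auto
            then show ?thesis using * q' N(2)[OF **(1)] by simp
          qed
          then show ?thesis by (simp add: simplex_chains_def)
        qed
        show ?thesis
          using insert.IH[OF v(2) L CL aL ba] q' by simp
      qed
      then obtain e where e: "e \<in> simplex_chains ?L q" "boundary V e = a" by blast
      have eV: "A \<subseteq> V - {v}" if "e A \<noteq> 0" for A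
      proof -
        have "v \<notin> A" "insert v A \<in> N" using e(1) that by (auto simp: simplex_chains_def)
        then show ?thesis using N(1) insert.prems(1) by blast
      qed
      have eN: "e \<in> simplex_chains N q"
        using e(1) down by (force simp: simplex_chains_def)
      have aV: "A \<subseteq> V - {v}" if "a A \<noteq> 0" for A
      proof -
        have "v \<notin> A" "insert v A \<in> N" using z[of "insert v A"] that by (auto simp: a_def split: if_splits)
        then show ?thesis using N(1) insert.prems(1) by blast
      qed
      \<comment> \<open>This is \<open>z\<close> plus the boundary of \<open>cone v e\<close>: a
        cycle homologous to \<open>z\<close> in which the part through \<open>v\<close> has
        cancelled.\<close>
      let ?z = "\<lambda>A. z A + (e A - cone v a A)"
      have bd: "boundary V (cone v e) = (\<lambda>A. e A - cone v a A)"
        using boundary_cone[OF \<open>finite V\<close> v(1), of e] eV e(2) by simp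
      have cone_a: "cone v a A = (if v \<in> A then z A else 0)" for A
        by (auto simp: cone_def a_def insert_absorb incidence_cancel)
      have "A \<in> ?D \<and> card A = q" if A: "?z A \<noteq> 0" for A
      proof -
        have "v \<notin> A \<and> (z A \<noteq> 0 \<or> e A \<noteq> 0)"
          using A eV[of A] by (cases "e A = 0") (auto simp: cone_a split: if_splits)
        then show ?thesis using z eN by (auto simp: simplex_chains_def)
      qed
      then have "?z \<in> simplex_chains ?D q" by (simp add: simplex_chains_def)
      moreover have "boundary V ?z = (\<lambda>_. 0)"
        using boundary_cone[OF \<open>finite V\<close> v(1), of a] aV ba e(2) insert.prems(6)
        by (simp add: boundary_add boundary_diff cone_zero)
      ultimately obtain e' where e': "e' \<in> simplex_chains ?D (Suc q)" "boundary V e' = ?z"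
        using insert.IH[OF v(2) D, of B' q ?z] B' by auto
      have "boundary V (\<lambda>A. e' A - cone v e A) = z"
        unfolding boundary_diff e'(2) bd by simp
      moreover have "(\<lambda>A. e' A - cone v e A) \<in> simplex_chains N (Suc q)"
      proof -
        have "cone v e \<in> simplex_chains N (Suc q)"
          using N(2) by (intro cone_in_simplex_chains[OF e(1)]) fastforce
        moreover have "e' \<in> simplex_chains N (Suc q)"
          using e'(1) by (simp add: simplex_chains_def)
        ultimately show ?thesis by (intro simplex_chains_diff)
      qed
      ultimately show ?thesis by blast
    qed
  qed
qed

section \<open>Fixed-point free acyclic carriers\<close>

text \<open>The terms cancel in pairs. No division by 2 occurs, so fields of characteristic 2 are
  covered.\<close>

lemma sum_antisymmetric:
  fixes f :: "'a \<Rightarrow> 'a \<Rightarrow> 'b::ab_group_add"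
  assumes "finite S" "\<And>v w. v \<in> S \<Longrightarrow> w \<in> S \<Longrightarrow> v \<noteq> w \<Longrightarrow> f v w = - f w v"
  shows "(\<Sum>v\<in>S. \<Sum>w\<in>S - {v}. f v w) = 0"
  using assms
proof (induction S rule: finite_induct)
  case (insert x S)
  have "(\<Sum>w\<in>insert x S - {v}. f v w) = f v x + (\<Sum>w\<in>S - {v}. f v w)" if "v \<in> S" for v
  proof -
    have "insert x S - {v} = insert x (S - {v})" using that insert.hyps by auto
    then show ?thesis using insert.hyps by simp
  qed
  moreover have "insert x S - {x} = S" using insert.hyps by auto
  moreover have "(\<Sum>w\<in>S. f x w) + (\<Sum>v\<in>S. f v x) = 0"
  proof -
    have "(\<Sum>w\<in>S. f x w) = (\<Sum>w\<in>S. - f w x)"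
      using insert.hyps by (intro sum.cong insert.prems) auto
    then show ?thesis by (simp add: sum_negf)
  qed
  moreover have "(\<Sum>v\<in>S. \<Sum>w\<in>S - {v}. f v w) = 0" by (rule insert.IH) (rule insert.prems, auto)
  ultimately show ?case using insert.hyps by (simp add: sum.distrib)
qed simp

text \<open>The cube \<open>[\<sigma>, \<sigma> \<union> \<rho>]\<close> in the face poset has the facets
  \<open>[\<sigma> \<union> {v}, \<sigma> \<union> \<rho>]\<close> and \<open>[\<sigma>, \<sigma> \<union> \<rho> - {v}]\<close> for \<open>v \<in> \<rho>\<close>; this is the image of its
  cellular boundary under \<open>G\<close>. A vertex has the empty simplex as augmentation.\<close>

definition cube_boundary ::
    "('a set \<Rightarrow> 'a set \<Rightarrow> 'a set \<Rightarrow> 'f::field) \<Rightarrow> 'a set \<Rightarrow> 'a set \<Rightarrow> 'a set \<Rightarrow> 'f" where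
  "cube_boundary G \<sigma> \<rho> A =
     (if \<rho> = {} then if A = {} then 1 else 0
      else \<Sum>v\<in>\<rho>. incidence v (\<rho> - {v}) * (G (insert v \<sigma>) (\<rho> - {v}) A - G \<sigma> (\<rho> - {v}) A))"

text \<open>A cube of dimension \<open>card \<rho>\<close> is sent to a chain of that dimension,
  hence the cardinality \<open>Suc (card \<rho>)\<close>. The carrier depends on the lowest face
  \<open>\<sigma>\<close> and the dimension only.\<close>

definition cube_filling ::
    "'a set \<Rightarrow> (nat \<Rightarrow> 'a set \<Rightarrow> 'a set set) \<Rightarrow>
      ('a set \<Rightarrow> 'a set \<Rightarrow> 'a set \<Rightarrow> 'f::field) \<Rightarrow> 'a set \<Rightarrow> 'a set \<Rightarrow> bool" where
  "cube_filling V K G \<sigma> \<rho> \<longleftrightarrow> G \<sigma> \<rho> \<in> simplex_chains (K (card \<rho>) \<sigma>) (Suc (card \<rho>)) \<and>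
     boundary V (G \<sigma> \<rho>) = cube_boundary G \<sigma> \<rho>"

text \<open>Acyclic carriers, by induction on the dimension of the cube: the images of the facets
  add up to a cycle, which \<open>mono\<close> places in the carrier of the cube and
  \<open>fill\<close> bounds there. For a vertex of the cube complex that cycle is the empty
  simplex, provided by \<open>empty\<close>.\<close>

lemma ex_cube_filling:
  fixes K :: "nat \<Rightarrow> 'a set \<Rightarrow> 'a set set"
  assumes X: "asimplicial_complex V X"
    and empty: "\<And>\<sigma>. \<sigma> \<in> X \<Longrightarrow> {} \<in> K 0 \<sigma>"
    and mono: "\<And>\<sigma> \<tau> q. \<tau> \<in> X \<Longrightarrow> \<sigma> \<subseteq> \<tau> \<Longrightarrow> K q \<tau> \<subseteq> K (Suc q) \<sigma>"
    and fill: "\<And>\<sigma> q (z :: 'a set \<Rightarrow> 'f::field). \<sigma> \<in> X \<Longrightarrow> z \<in> simplex_chains (K q \<sigma>) q \<Longrightarrow>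
      boundary V z = (\<lambda>_. 0) \<Longrightarrow> \<exists>e\<in>simplex_chains (K q \<sigma>) (Suc q). boundary V e = z"
  shows "\<exists>G :: 'a set \<Rightarrow> 'a set \<Rightarrow> 'a set \<Rightarrow> 'f.
    \<forall>\<sigma> \<rho>. \<sigma> \<union> \<rho> \<in> X \<longrightarrow> \<sigma> \<inter> \<rho> = {} \<longrightarrow> card \<rho> < n \<longrightarrow> cube_filling V K G \<sigma> \<rho>"
proof (induction n)
  case (Suc n)
  then obtain G :: "'a set \<Rightarrow> 'a set \<Rightarrow> 'a set \<Rightarrow> 'f"
    where G: "\<And>\<sigma> \<rho>. \<sigma> \<union> \<rho> \<in> X \<Longrightarrow> \<sigma> \<inter> \<rho> = {} \<Longrightarrow> card \<rho> < n \<Longrightarrow> cube_filling V K G \<sigma> \<rho>"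
    by blast
  have down: "\<tau> \<in> X" if "\<sigma> \<in> X" "\<tau> \<subseteq> \<sigma>" for \<sigma> \<tau>
    using that X by (auto simp: asimplicial_complex_def)
  have fin: "finite \<sigma>" if "\<sigma> \<in> X" for \<sigma>
    using that X finite_subset by (auto simp: asimplicial_complex_def)
  have step: "\<exists>e\<in>simplex_chains (K n \<sigma>) (Suc n). boundary V e = cube_boundary G \<sigma> \<rho>"
    if cube: "\<sigma> \<union> \<rho> \<in> X" "\<sigma> \<inter> \<rho> = {}" "card \<rho> = n" for \<sigma> \<rho>
  proof (rule fill)
    show "\<sigma> \<in> X" using down cube(1) by blast
    have \<rho>: "finite \<rho>" using fin cube(1) by fastforce
    have facets: "cube_filling V K G (insert v \<sigma>) (\<rho> - {v})" "cube_filling V K G \<sigma> (\<rho> - {v})"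
      "Suc (card (\<rho> - {v})) = n" if "v \<in> \<rho>" for v
    proof -
      show *: "Suc (card (\<rho> - {v})) = n" using card_Suc_Diff1[OF \<rho> that] cube(3) by (simp only:)
      have "insert v \<sigma> \<union> (\<rho> - {v}) = \<sigma> \<union> \<rho>" using that by auto
      then show "cube_filling V K G (insert v \<sigma>) (\<rho> - {v})"
        using cube * by (intro G) auto
      have "\<sigma> \<union> (\<rho> - {v}) \<in> X" by (rule down[OF cube(1)]) auto
      then show "cube_filling V K G \<sigma> (\<rho> - {v})"
        using cube * by (intro G) auto
    qed
    show "cube_boundary G \<sigma> \<rho> \<in> simplex_chains (K n \<sigma>) n"
    proof -
      have "A \<in> K n \<sigma> \<and> card A = n" if A: "cube_boundary G \<sigma> \<rho> A \<noteq> 0" for A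
      proof (cases "\<rho> = {}")
        case True
        then show ?thesis using A cube(3) empty[OF \<open>\<sigma> \<in> X\<close>]
          by (auto simp: cube_boundary_def split: if_splits)
      next
        case False
        have "\<exists>v\<in>\<rho>. G (insert v \<sigma>) (\<rho> - {v}) A \<noteq> 0 \<or> G \<sigma> (\<rho> - {v}) A \<noteq> 0"
        proof (rule ccontr)
          assume "\<not> ?thesis"
          then have "cube_boundary G \<sigma> \<rho> A = 0" using False by (simp add: cube_boundary_def)
          then show False using A by simp
        qed
        then obtain v where v: "v \<in> \<rho>" "G (insert v \<sigma>) (\<rho> - {v}) A \<noteq> 0 \<or> G \<sigma> (\<rho> - {v}) A \<noteq> 0"
          by blast
        define m where "m = card (\<rho> - {v})"
        have m: "Suc m = n" using facets(3)[OF v(1)] by (simp add: m_def)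
        have "A \<in> K m (insert v \<sigma>) \<or> A \<in> K m \<sigma>" "card A = Suc m"
          using facets(1,2)[OF v(1)] v(2)
          by (auto simp: cube_filling_def simplex_chains_def m_def)
        moreover have "insert v \<sigma> \<in> X" using down[OF cube(1)] v(1) by blast
        then have "K m (insert v \<sigma>) \<subseteq> K n \<sigma>" "K m \<sigma> \<subseteq> K n \<sigma>"
          using mono[of "insert v \<sigma>" \<sigma> m] mono[OF \<open>\<sigma> \<in> X\<close>, of \<sigma> m] m by auto
        ultimately show ?thesis using m by auto
      qed
      then show ?thesis by (simp add: simplex_chains_def)
    qed
    show "boundary V (cube_boundary G \<sigma> \<rho>) = (\<lambda>_. 0)"
    proof (cases "\<rho> = {}")
      case True
      then show ?thesis by (simp add: boundary_def cube_boundary_def fun_eq_iff)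
    next
      case False
      \<comment> \<open>The alternating sum over the four faces of codimension 2 obtained by fixing
        the directions \<open>v\<close> and \<open>w\<close>. It is symmetric in \<open>v\<close>
        and \<open>w\<close>, while the product of incidences is antisymmetric.\<close>
      define d where "d v w A = G (insert w (insert v \<sigma>)) (\<rho> - {v} - {w}) A - G (insert v \<sigma>) (\<rho> - {v} - {w}) A
          - (G (insert w \<sigma>) (\<rho> - {v} - {w}) A - G \<sigma> (\<rho> - {v} - {w}) A)" for v w A
      have "boundary V (cube_boundary G \<sigma> \<rho>) A = 0" for A
      proof -
        have "cube_boundary G \<sigma> \<rho> = (\<lambda>A. \<Sum>v\<in>\<rho>. incidence v (\<rho> - {v}) *
            (G (insert v \<sigma>) (\<rho> - {v}) A - G \<sigma> (\<rho> - {v}) A))"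
          using False by (simp add: cube_boundary_def fun_eq_iff)
        then have "boundary V (cube_boundary G \<sigma> \<rho>) A =
            (\<Sum>v\<in>\<rho>. incidence v (\<rho> - {v}) *
              (cube_boundary G (insert v \<sigma>) (\<rho> - {v}) A - cube_boundary G \<sigma> (\<rho> - {v}) A))"
          using facets(1,2) by (simp add: boundary_sum boundary_diff cube_filling_def)
        also have "\<dots> = (\<Sum>v\<in>\<rho>. \<Sum>w\<in>\<rho> - {v}.
            incidence v (\<rho> - {v}) * incidence w (\<rho> - {v} - {w}) * d v w A)"
        proof (rule sum.cong)
          fix v
          show "incidence v (\<rho> - {v}) *
              (cube_boundary G (insert v \<sigma>) (\<rho> - {v}) A - cube_boundary G \<sigma> (\<rho> - {v}) A) =
            (\<Sum>w\<in>\<rho> - {v}. incidence v (\<rho> - {v}) * incidence w (\<rho> - {v} - {w}) * d v w A)"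
          proof (cases "\<rho> - {v} = {}")
            \<comment> \<open>The cube is an edge, and its two endpoints have the same
              augmentation.\<close>
            case True
            show ?thesis unfolding True by (simp add: cube_boundary_def)
          next
            case nonempty: False
            show ?thesis
              unfolding cube_boundary_def d_def if_not_P[OF nonempty]
              by (simp add: sum_distrib_left mult.assoc right_diff_distrib sum_subtractf)
          qed
        qed simp
        also have "\<dots> = 0"
        proof (rule sum_antisymmetric[OF \<rho>])
          fix v w assume vw: "v \<in> \<rho>" "w \<in> \<rho>" "v \<noteq> w"
          define B where "B = \<rho> - {v} - {w}"
          have B: "\<rho> - {v} = insert w B" "\<rho> - {w} = insert v B" "\<rho> - {w} - {v} = B"
              "finite B" "v \<notin> B" "w \<notin> B"
            using vw \<rho> by (auto simp: B_def)
          have "d v w A = d w v A"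
            using B(3) unfolding d_def B_def[symmetric] by (simp add: insert_commute)
          moreover have "incidence v (insert w B) * incidence w B =
              - (incidence w (insert v B) * incidence v B :: 'f)"
            using B(4-6) vw(3) by (rule incidence_anticommute)
          ultimately show "incidence v (\<rho> - {v}) * incidence w (\<rho> - {v} - {w}) * d v w A =
              - (incidence w (\<rho> - {w}) * incidence v (\<rho> - {w} - {v}) * d w v A)"
            by (simp add: B(1,2,5,6))
        qed
        finally show ?thesis .
      qed
      then show ?thesis by (simp add: fun_eq_iff)
    qed
  qed
  define E where "E \<sigma> \<rho> = (SOME e. e \<in> simplex_chains (K n \<sigma>) (Suc n) \<and>
    boundary V e = cube_boundary G \<sigma> \<rho>)" for \<sigma> \<rho>
  \<comment> \<open>Facets have dimension below \<open>n\<close>, so extending \<open>G\<close> by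
    \<open>E\<close> does not change the cycles to be filled.\<close>
  define G' where "G' \<sigma> \<rho> = (if card \<rho> < n then G \<sigma> \<rho> else E \<sigma> \<rho>)" for \<sigma> \<rho>
  have "cube_filling V K G' \<sigma> \<rho>"
    if cube: "\<sigma> \<union> \<rho> \<in> X" "\<sigma> \<inter> \<rho> = {}" "card \<rho> < Suc n" for \<sigma> \<rho>
  proof -
    have "finite \<rho>" using fin cube(1) by fastforce
    then have "card (\<rho> - {v}) < n" if "v \<in> \<rho>" for v
      using that cube(3) card_Diff1_less[of \<rho> v] by linarith
    then have "cube_boundary G' \<sigma> \<rho> = cube_boundary G \<sigma> \<rho>"
      by (simp add: cube_boundary_def G'_def fun_eq_iff)
    moreover have "E \<sigma> \<rho> \<in> simplex_chains (K n \<sigma>) (Suc n) \<and> boundary V (E \<sigma> \<rho>) = cube_boundary G \<sigma> \<rho>"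
      if "card \<rho> = n"
    proof -
      have "\<exists>e. e \<in> simplex_chains (K n \<sigma>) (Suc n) \<and> boundary V e = cube_boundary G \<sigma> \<rho>"
        using step[OF cube(1,2) that] by blast
      then show ?thesis unfolding E_def by (rule someI_ex)
    qed
    ultimately show ?thesis
      using G[OF cube(1,2)] cube(3) by (cases "card \<rho> = n") (simp_all add: cube_filling_def G'_def)
  qed
  then show ?case by blast
qed simp

text \<open>A Lefschetz argument: \<open>H = G {}\<close> is a null-homotopy of the chain map
  \<open>\<tau> \<mapsto> \<Sum>v\<in>\<tau>. \<plusminus> G {v} (\<tau> - {v})\<close>, so the alternating trace of the latter vanishes on the
  augmented chain complex. On the empty simplex it contributes \<open>1\<close>, and on the other
  simplices \<open>0\<close>, since \<open>G {v}\<close> avoids \<open>v\<close>.\<close>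

lemma no_acyclic_carrier:
  fixes K :: "nat \<Rightarrow> 'a set \<Rightarrow> 'a set set"
  assumes X: "asimplicial_complex V X" "X \<noteq> {}"
    and empty: "\<And>\<sigma>. \<sigma> \<in> X \<Longrightarrow> {} \<in> K 0 \<sigma>"
    and mono: "\<And>\<sigma> \<tau> q. \<tau> \<in> X \<Longrightarrow> \<sigma> \<subseteq> \<tau> \<Longrightarrow> K q \<tau> \<subseteq> K (Suc q) \<sigma>"
    and fill: "\<And>\<sigma> q (z :: 'a set \<Rightarrow> 'f::field). \<sigma> \<in> X \<Longrightarrow> z \<in> simplex_chains (K q \<sigma>) q \<Longrightarrow>
      boundary V z = (\<lambda>_. 0) \<Longrightarrow> \<exists>e\<in>simplex_chains (K q \<sigma>) (Suc q). boundary V e = z"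
    and carrier: "\<And>q \<sigma> A. \<sigma> \<in> X \<Longrightarrow> A \<in> K q \<sigma> \<Longrightarrow> A \<in> X \<and> A \<inter> \<sigma> = {}"
  shows False
proof -
  have V: "finite V" using X by (simp add: asimplicial_complex_def)
  have XV: "X \<subseteq> Pow V" using X by (simp add: asimplicial_complex_def)
  have down: "\<tau> \<in> X" if "\<sigma> \<in> X" "\<tau> \<subseteq> \<sigma>" for \<sigma> \<tau>
    using that X by (auto simp: asimplicial_complex_def)
  have fin: "finite X" "\<And>\<rho>. \<rho> \<in> X \<Longrightarrow> finite \<rho>"
    using finite_subset[OF XV] finite_subset[of _ V] XV V by auto
  have nonempty: "{} \<in> X" using X(2) down by blast
  \<comment> \<open>No simplex has more than \<open>card V\<close> elements, so this bound reaches
    every cube.\<close>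
  obtain G :: "'a set \<Rightarrow> 'a set \<Rightarrow> 'a set \<Rightarrow> 'f" where
    G: "\<And>\<sigma> \<rho>. \<sigma> \<union> \<rho> \<in> X \<Longrightarrow> \<sigma> \<inter> \<rho> = {} \<Longrightarrow> card \<rho> < Suc (card V) \<Longrightarrow> cube_filling V K G \<sigma> \<rho>"
    using ex_cube_filling[of V X K "Suc (card V)", OF X(1) empty mono fill] by blast
  have G': "cube_filling V K G \<sigma> \<rho>" if "\<sigma> \<union> \<rho> \<in> X" "\<sigma> \<inter> \<rho> = {}" for \<sigma> \<rho>
    using G[OF that] that XV V card_mono[of V \<rho>] by auto
  define H where "H = G {}"
  define s :: "'a set \<Rightarrow> 'f" where "s \<rho> = (- 1) ^ card \<rho>" for \<rho>
  have s_remove: "s (\<rho> - {v}) = - s \<rho>" if "\<rho> \<in> X" "v \<in> \<rho>" for \<rho> v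
  proof -
    have "card \<rho> = Suc (card (\<rho> - {v}))"
      using card_Suc_Diff1[OF fin(2)[OF that(1)] that(2)] by (rule sym)
    then show ?thesis unfolding s_def by (simp only: power_Suc) simp
  qed
  have HX: "A \<in> X" if "\<rho> \<in> X" "H \<rho> A \<noteq> 0" for \<rho> A
    using G'[of "{}" \<rho>] that carrier[of "{}" A "card \<rho>"] nonempty
    by (auto simp: cube_filling_def simplex_chains_def H_def)
  have diag: "boundary V (H \<rho>) \<rho> = - (\<Sum>v\<in>\<rho>. incidence v (\<rho> - {v}) * H (\<rho> - {v}) \<rho>)"
    if \<rho>: "\<rho> \<in> X" "\<rho> \<noteq> {}" for \<rho>
  proof -
    have "G {v} (\<rho> - {v}) \<rho> = 0" if "v \<in> \<rho>" for v
    proof -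
      have "{v} \<in> X" "{v} \<union> (\<rho> - {v}) = \<rho>" using that \<rho> down by auto
      then show ?thesis using G'[of "{v}" "\<rho> - {v}"] \<rho> carrier[of "{v}" \<rho>] that
        by (auto simp: cube_filling_def simplex_chains_def)
    qed
    then have "cube_boundary G {} \<rho> \<rho> = - (\<Sum>v\<in>\<rho>. incidence v (\<rho> - {v}) * H (\<rho> - {v}) \<rho>)"
      using \<rho> by (simp add: cube_boundary_def H_def sum_negf)
    then show ?thesis using G'[of "{}" \<rho>] \<rho> by (simp add: cube_filling_def H_def)
  qed
  have "boundary V (H {}) {} = 1"
    using G'[of "{}" "{}"] nonempty by (simp add: cube_filling_def cube_boundary_def H_def)
  \<comment> \<open>The alternating trace of \<partial>H will turn out to be 1 plus itself. Removing
    \<open>v\<close> from \<rho> reindexes the remaining double sum and flips \<open>s\<close>; this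
    is the cyclicity of the trace, tr(H\<partial>) = tr(\<partial>H), written out.\<close>
  then have "(\<Sum>\<rho>\<in>X. s \<rho> * boundary V (H \<rho>) \<rho>) =
      1 - (\<Sum>\<rho>\<in>X - {{}}. \<Sum>v\<in>\<rho>. s \<rho> * (incidence v (\<rho> - {v}) * H (\<rho> - {v}) \<rho>))"
    using sum.remove[OF fin(1) nonempty, of "\<lambda>\<rho>. s \<rho> * boundary V (H \<rho>) \<rho>"] diag
    by (simp add: s_def sum_negf sum_distrib_left)
  also have "(\<Sum>\<rho>\<in>X - {{}}. \<Sum>v\<in>\<rho>. s \<rho> * (incidence v (\<rho> - {v}) * H (\<rho> - {v}) \<rho>)) =
      (\<Sum>(\<rho>, v)\<in>(SIGMA \<rho>:X - {{}}. \<rho>). s \<rho> * (incidence v (\<rho> - {v}) * H (\<rho> - {v}) \<rho>))"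
    using fin by (subst sum.Sigma) auto
  also have "\<dots> = (\<Sum>(\<rho>, v)\<in>(SIGMA \<rho>:X. {v \<in> V - \<rho>. insert v \<rho> \<in> X}).
      - (s \<rho> * (incidence v \<rho> * H \<rho> (insert v \<rho>))))"
  proof (rule sum.reindex_bij_witness[of _ "\<lambda>(\<rho>, v). (insert v \<rho>, v)" "\<lambda>(\<rho>, v). (\<rho> - {v}, v)"])
    fix x assume "x \<in> (SIGMA \<rho>:X - {{}}. \<rho>)"
    then obtain \<rho> v where x: "x = (\<rho>, v)" "\<rho> \<in> X" "v \<in> \<rho>" by auto
    then show "(\<lambda>(\<rho>, v). (insert v \<rho>, v)) ((\<lambda>(\<rho>, v). (\<rho> - {v}, v)) x) = x"
      by (simp add: insert_absorb)
    show "(\<lambda>(\<rho>, v). (\<rho> - {v}, v)) x \<in> (SIGMA \<rho>:X. {v \<in> V - \<rho>. insert v \<rho> \<in> X})"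
      using x XV down[of \<rho> "\<rho> - {v}"] by (auto simp: insert_absorb)
    show "(case (\<lambda>(\<rho>, v). (\<rho> - {v}, v)) x of (\<rho>, v) \<Rightarrow>
          - (s \<rho> * (incidence v \<rho> * H \<rho> (insert v \<rho>)))) =
        (case x of (\<rho>, v) \<Rightarrow> s \<rho> * (incidence v (\<rho> - {v}) * H (\<rho> - {v}) \<rho>))"
      using x s_remove[of \<rho> v] by (simp add: insert_absorb)
  next
    fix y assume "y \<in> (SIGMA \<rho>:X. {v \<in> V - \<rho>. insert v \<rho> \<in> X})"
    then show "(\<lambda>(\<rho>, v). (\<rho> - {v}, v)) ((\<lambda>(\<rho>, v). (insert v \<rho>, v)) y) = y"
      and "(\<lambda>(\<rho>, v). (insert v \<rho>, v)) y \<in> (SIGMA \<rho>:X - {{}}. \<rho>)"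
      by auto
  qed
  also have "\<dots> = - (\<Sum>\<rho>\<in>X. \<Sum>v\<in>{v \<in> V - \<rho>. insert v \<rho> \<in> X}.
      s \<rho> * (incidence v \<rho> * H \<rho> (insert v \<rho>)))"
    using fin V by (subst sum.Sigma) (auto simp: sum_negf case_prod_beta)
  also have "\<dots> = - (\<Sum>\<rho>\<in>X. s \<rho> * boundary V (H \<rho>) \<rho>)"
  proof -
    have "(\<Sum>v\<in>{v \<in> V - \<rho>. insert v \<rho> \<in> X}. s \<rho> * (incidence v \<rho> * H \<rho> (insert v \<rho>))) =
        s \<rho> * boundary V (H \<rho>) \<rho>" if "\<rho> \<in> X" for \<rho>
      unfolding boundary_def sum_distrib_left using V HX[OF that]
      by (intro sum.mono_neutral_left) auto
    then show ?thesis by simp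
  qed
  finally show False by simp
qed

section \<open>Reduced homology and the relative Leray number\<close>

text \<open>The unit of the quotient is the set of boundaries. In a trivial quotient it is also the
  coset of the cycle, which contains the cycle because the zero chain is a boundary.\<close>

lemma trivial_homology_cycle_fill:
  fixes K :: "'a set set" and z :: "'a set \<Rightarrow> 'f::field"
  assumes K: "finite V" "K \<subseteq> Pow V"
    and triv: "trivial_group (reduced_simplicial_homology K (int q - 1) :: ('a list \<Rightarrow> 'f) set monoid)"
    and z: "z \<in> simplex_chains K q" "boundary V z = (\<lambda>_. 0)"
  shows "\<exists>e\<in>simplex_chains K (Suc q). boundary V e = z"
proof -
  let ?z = "alternating_extension z"
  let ?Z = "cycle_group K (int q - 1) :: ('a list \<Rightarrow> 'f) monoid"
  let ?B = "simplicial_boundaries K (int q - 1) :: ('a list \<Rightarrow> 'f) set"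
  have "simplicial_boundary K ?z = (\<lambda>_. 0)"
    using simplicial_boundary_alternating_extension[OF K z(1)] z(2)
    by (simp add: alternating_extension_def fun_eq_iff)
  then have "?z \<in> carrier ?Z"
    using alternating_extension_in_oriented_chains[OF z(1)]
    by (simp add: cycle_group_def simplicial_cycles_def)
  then have "?B #>\<^bsub>?Z\<^esub> ?z = ?B"
    using triv by (auto simp: trivial_group_def reduced_simplicial_homology_def carrier_FactGroup)
  moreover have "(\<lambda>_. 0) \<in> oriented_chains K (int q)"
    by (simp add: oriented_chains_def)
  then have "(\<lambda>_. 0) \<in> ?B"
    unfolding simplicial_boundaries_def
    by (intro image_eqI[of _ _ "\<lambda>_. 0"]) (simp_all add: simplicial_boundary_def)
  then have "?z \<in> ?B #>\<^bsub>?Z\<^esub> ?z"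
    by (auto simp: r_coset_def cycle_group_def intro!: bexI[of _ "\<lambda>_. 0"])
  ultimately obtain e' where e': "e' \<in> oriented_chains K (int (Suc q) - 1)"
    "simplicial_boundary K e' = ?z"
    by (auto simp: simplicial_boundaries_def)
  obtain e where e: "e \<in> simplex_chains K (Suc q)" "e' = alternating_extension e"
    using oriented_chain_eq_alternating_extension[OF e'(1)] by blast
  have "alternating_extension (boundary V e) = ?z"
    using simplicial_boundary_alternating_extension[OF K e(1)] e(2) e'(2) by simp
  have "boundary V e A = z A" for A
  proof (cases "finite A")
    case True
    then obtain xs where xs: "set xs = A" "distinct xs" using finite_distinct_list by blast
    then have "of_int (list_sign xs) * boundary V e A = of_int (list_sign xs) * z A"
      using fun_cong[OF \<open>alternating_extension (boundary V e) = ?z\<close>, of xs]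
      by (simp add: alternating_extension_def)
    then have "of_int (list_sign xs) * (of_int (list_sign xs) * boundary V e A) =
        of_int (list_sign xs) * (of_int (list_sign xs) * z A)" by simp
    then show ?thesis by (simp only: of_int_list_sign_cancel)
  next
    case False
    \<comment> \<open>Lists do not see infinite sets, but chains on subsets of the finite
      \<open>V\<close> vanish there.\<close>
    then have "\<not> insert v A \<subseteq> V" "\<not> A \<subseteq> V" for v using K(1) finite_subset by auto
    then have "e (insert v A) = 0" "z A = 0" for v
      using e(1) z(1) K(2) unfolding simplex_chains_def by blast+
    then show ?thesis by (simp add: boundary_def)
  qed
  then show ?thesis using e(1) by blast
qed

text \<open>A simplex on \<open>V\<close> has dimension below \<open>card V\<close>, so the chain
  groups themselves are zero from this degree on.\<close>

lemma trivial_homology_above_dimension: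
  fixes K :: "'a set set"
  assumes V: "finite V" "K \<subseteq> Pow V" and i: "int (card V) \<le> i"
  shows "trivial_group (reduced_simplicial_homology K i :: ('a list \<Rightarrow> 'f::field) set monoid)"
proof -
  have "length xs \<le> card V" if "distinct xs" "set xs \<in> K" for xs
    using that V card_mono[OF V(1), of "set xs"] distinct_card by fastforce
  then have "oriented_chains K j \<subseteq> {\<lambda>_. 0 :: 'f}" if "i \<le> j" for j
    using that i by (fastforce simp: oriented_chains_def fun_eq_iff)
  moreover have "(\<lambda>_. 0 :: 'f) \<in> oriented_chains K j" for j
    by (simp add: oriented_chains_def)
  ultimately have chains: "oriented_chains K j = {\<lambda>_. 0 :: 'f}" if "i \<le> j" for j
    using that by blast
  have "simplicial_cycles K i = {\<lambda>_. 0 :: 'f}" "simplicial_boundaries K i = {\<lambda>_. 0 :: 'f}"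
    by (auto simp: simplicial_cycles_def simplicial_boundaries_def chains simplicial_boundary_def)
  then show ?thesis
    unfolding trivial_group_def reduced_simplicial_homology_def
    by (auto simp: FactGroup_def RCOSETS_def r_coset_def set_mult_def cycle_group_def
        intro!: groupI)
qed

lemma homology_vanishes_above_relative_leray_number:
  fixes F :: "'f::field itself"
  assumes "finite V" "X \<subseteq> Pow V" "\<sigma> \<in> Y" "int (relative_leray_number F V Y X) \<le> i"
  shows "trivial_group
    (reduced_simplicial_homology (induced_subcomplex X (V - \<sigma>)) i :: ('a list \<Rightarrow> 'f) set monoid)"
proof -
  let ?P = "\<lambda>d. \<forall>i\<ge>int d. \<forall>\<sigma>\<in>Y. trivial_group
    (reduced_simplicial_homology (induced_subcomplex X (V - \<sigma>)) i :: ('a list \<Rightarrow> 'f) set monoid)"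
  \<comment> \<open>A witness that the minimum in the Leray number is attained.\<close>
  have "?P (card V)"
    using assms(1,2)
    by (auto intro!: trivial_homology_above_dimension simp: induced_subcomplex_def)
  then have "?P (relative_leray_number F V Y X)"
    unfolding relative_leray_number_def by (rule LeastI)
  then show ?thesis using assms(3,4) by blast
qed

section \<open>Restriction and rank of matroids\<close>

lemma matroid_restriction:
  assumes "matroid V M" "S \<subseteq> V"
  shows "matroid S (induced_subcomplex M S)"
proof -
  have "finite S" using assms finite_subset by (auto simp: matroid_def asimplicial_complex_def)
  moreover have "{} \<in> M" using assms(1) by (auto simp: matroid_def asimplicial_complex_def)
  moreover have "\<exists>b\<in>B - A. insert b A \<in> induced_subcomplex M S"
    if AB: "A \<in> induced_subcomplex M S" "B \<in> induced_subcomplex M S" "card A < card B" for A B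
  proof -
    have "A \<in> M" "B \<in> M" using AB by (auto simp: induced_subcomplex_def)
    then obtain b where "b \<in> B - A" "insert b A \<in> M"
      using AB(3) assms(1) unfolding matroid_def by blast
    then show ?thesis using AB by (auto simp: induced_subcomplex_def)
  qed
  ultimately show ?thesis
    using assms(1) by (auto simp: matroid_def asimplicial_complex_def induced_subcomplex_def)
qed

lemma ex_card_matroid_rank:
  assumes "matroid V M"
  shows "\<exists>B\<in>induced_subcomplex M S. card B = matroid_rank M S"
proof -
  have "M \<subseteq> Pow V" "finite V" using assms by (auto simp: matroid_def asimplicial_complex_def)
  then have "finite M" using finite_subset by blast
  moreover have "{} \<in> M" using assms by (auto simp: matroid_def asimplicial_complex_def)
  ultimately have "Max (card ` {A \<in> M. A \<subseteq> S}) \<in> card ` {A \<in> M. A \<subseteq> S}"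
    by (intro Max_in) auto
  then show ?thesis by (auto simp: matroid_rank_def induced_subcomplex_def)
qed

theorem theorem1p6:
  fixes F :: "'f::field itself"
    and V :: "'a set"
    and X Y M :: "'a set set"
  assumes "finite V"
    and "asimplicial_complex V X"
    and "asimplicial_complex V Y"
    and "matroid V M"
    and "alexander_dual V Y \<subseteq> M"
    and "M \<subseteq> X"
  shows "\<exists>\<sigma>\<in>X. matroid_rank M (V - \<sigma>) \<le> relative_leray_number F V Y X"
proof (rule ccontr)
  define d where "d = relative_leray_number F V Y X"
  \<comment> \<open>The carrier at \<open>q\<close> only has to fill cycles of dimension
    \<open>q - 1\<close>. For \<open>q \<le> d\<close> the rank above \<open>d\<close> fills them in
    \<open>M\<close>; for \<open>q > d\<close> their dimension is at least \<open>d\<close>, within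
    reach of the Leray number.\<close>
  define K where "K q \<sigma> = induced_subcomplex (if q \<le> d then M else X) (V - \<sigma>)" for q and \<sigma> :: "'a set"
  assume "\<not> ?thesis"
  then have rank: "d < matroid_rank M (V - \<sigma>)" if "\<sigma> \<in> X" for \<sigma>
    using that by (auto simp: d_def not_le)
  have X: "X \<subseteq> Pow V" using assms(2) by (simp add: asimplicial_complex_def)
  have M: "{} \<in> M" "\<And>A B. A \<in> M \<Longrightarrow> B \<subseteq> A \<Longrightarrow> B \<in> M"
    using assms(4) by (auto simp: matroid_def asimplicial_complex_def)
  show False
  proof (rule no_acyclic_carrier[OF assms(2), where K = K])
    fix \<sigma> q and z :: "'a set \<Rightarrow> 'f"
    assume \<sigma>: "\<sigma> \<in> X" and z: "z \<in> simplex_chains (K q \<sigma>) q" "boundary V z = (\<lambda>_. 0)"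
    obtain B where B: "B \<in> induced_subcomplex M (V - \<sigma>)" "d < card B"
      using ex_card_matroid_rank[OF assms(4)] rank[OF \<sigma>] by metis
    have mat: "matroid (V - \<sigma>) (induced_subcomplex M (V - \<sigma>))"
      using assms(4) by (rule matroid_restriction) auto
    show "\<exists>e\<in>simplex_chains (K q \<sigma>) (Suc q). boundary V e = z"
    proof (cases "q \<le> d")
      case True
      then show ?thesis
        using matroid_cycle_fill[OF assms(1) _ mat B(1), of q z] B(2) z by (auto simp: K_def)
    next
      case False
      show ?thesis
      proof (cases "\<sigma> \<in> Y")
        case True
        have "trivial_group (reduced_simplicial_homology (K q \<sigma>) (int q - 1) ::
            ('a list \<Rightarrow> 'f) set monoid)"
          using homology_vanishes_above_relative_leray_number[OF assms(1) X True, of F "int q - 1"] False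
          by (simp add: K_def d_def)
        then show ?thesis
          using z X by (intro trivial_homology_cycle_fill[OF assms(1)])
            (auto simp: K_def induced_subcomplex_def)
      next
        case False
        \<comment> \<open>Here the carrier is the full simplex on \<open>V - \<sigma>\<close>, so
          coning from any vertex fills the cycle; \<open>B\<close> is nonempty by
          \<open>d < card B\<close> and supplies one.\<close>
        have "V - (V - \<sigma>) = \<sigma>" using \<sigma> X by auto
        then have "V - \<sigma> \<in> alexander_dual V Y"
          using False by (simp add: alexander_dual_def)
        then have "V - \<sigma> \<in> X" using assms(5,6) by blast
        then have full: "A \<in> K q \<sigma>" if "A \<subseteq> V - \<sigma>" for A
          using that assms(2) \<open>\<not> q \<le> d\<close>
          by (auto simp: K_def induced_subcomplex_def asimplicial_complex_def)
        obtain v where "v \<in> B" using B(2) by fastforce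
        then have "v \<in> V - \<sigma>" using B(1) by (auto simp: induced_subcomplex_def)
        then show ?thesis
          using full by (intro cone_cycle_fill[OF assms(1) _ z, of v])
            (auto simp: K_def induced_subcomplex_def)
      qed
    qed
  \<comment> \<open>Where the carriers switch from \<open>M\<close> to \<open>X\<close>,
    monotonicity is the inclusion \<open>M \<subseteq> X\<close>; they avoid \<sigma> because they
    lie over \<open>V - \<sigma>\<close>.\<close>
  qed (use assms(6) M in \<open>auto simp: K_def induced_subcomplex_def split: if_splits\<close>)
qed

end
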